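(* Let $X$ be a second-countable topological space. Then $\mathcal{M}$, the assignment sending each open subset $U\subset X$ to the set $\mathcal{M}(U)$ of Borel measures on $U$ together with restriction of measures, is a sheaf of sets on $X$.
   Context: For an open subset $U\subset X$, $\mathcal{M}(U)=\{\mu:\mathcal{B}(U)\to[0,\infty]\mid\mu\text{ is a Borel measure}\}$, where $\mathcal{B}(U)$ is the Borel $\sigma$-algebra of $U$. For open $V\subset U$ the restriction map $\mathcal{M}(U)\to\mathcal{M}(V)$ is $\mu\mapsto\mu|_V$, $\mu|_V(B)=\mu(B)$ for Borel $B\subset V$. A presheaf of sets on $X$ is a contravariant functor from the poset of open subsets of $X$ (ordered by inclusion) to sets. A presheaf $\mathcal{F}$ is a sheaf if for every open $W\subset X$ and every open cover $\mathcal{U}$ of $W$: (Locality) if $s,t\in\mathcal{F}(W)$ satisfy $s|_U=t|_U$ for all $U\in\mathcal{U}$, then $s=t$; (Gluing) if $s_U\in\mathcal{F}(U)$, $U\in\mathcal{U}$, satisfy $s_U|_{U\cap V}=s_V|_{U\cap V}$ for all $U,V\in\mathcal{U}$, then there is $s\in\mathcal{F}(W)$ with $s|_U=s_U$ for all $U\in\mathcal{U}$. *)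

theory Defs
  imports "HOL-Analysis.Analysis"
begin

(* A functor from the opposite of the poset of open sets of X to sets. All the sets F U
   live in one type 'b, and res U V is the restriction map F U -> F V for open V \<subseteq> U.
   Only the values of res U V on F U matter. *)
definition presheaf_of_sets ::
    "'a topology \<Rightarrow> ('a set \<Rightarrow> 'b set) \<Rightarrow> ('a set \<Rightarrow> 'a set \<Rightarrow> 'b \<Rightarrow> 'b) \<Rightarrow> bool" where
  "presheaf_of_sets X F res \<longleftrightarrow>
     (\<forall>U V. openin X U \<and> openin X V \<and> V \<subseteq> U \<longrightarrow> res U V \<in> F U \<rightarrow> F V) \<and>
     (\<forall>U. openin X U \<longrightarrow> (\<forall>s\<in>F U. res U U s = s)) \<and>
     (\<forall>U V W. openin X U \<and> openin X V \<and> openin X W \<and> W \<subseteq> V \<and> V \<subseteq> U \<longrightarrow>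
        (\<forall>s\<in>F U. res V W (res U V s) = res U W s))"

definition open_cover :: "'a topology \<Rightarrow> 'a set set \<Rightarrow> 'a set \<Rightarrow> bool" where
  "open_cover X \<U> W \<longleftrightarrow> (\<forall>U\<in>\<U>. openin X U) \<and> \<Union>\<U> = W"

definition sheaf_locality ::
    "'a topology \<Rightarrow> ('a set \<Rightarrow> 'b set) \<Rightarrow> ('a set \<Rightarrow> 'a set \<Rightarrow> 'b \<Rightarrow> 'b) \<Rightarrow> bool" where
  "sheaf_locality X F res \<longleftrightarrow>
     (\<forall>W \<U>. openin X W \<and> open_cover X \<U> W \<longrightarrow>
        (\<forall>s\<in>F W. \<forall>t\<in>F W. (\<forall>U\<in>\<U>. res W U s = res W U t) \<longrightarrow> s = t))"

definition sheaf_gluing ::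
    "'a topology \<Rightarrow> ('a set \<Rightarrow> 'b set) \<Rightarrow> ('a set \<Rightarrow> 'a set \<Rightarrow> 'b \<Rightarrow> 'b) \<Rightarrow> bool" where
  "sheaf_gluing X F res \<longleftrightarrow>
     (\<forall>W \<U>. openin X W \<and> open_cover X \<U> W \<longrightarrow>
        (\<forall>\<sigma>. (\<forall>U\<in>\<U>. \<sigma> U \<in> F U) \<and>
             (\<forall>U\<in>\<U>. \<forall>V\<in>\<U>. res U (U \<inter> V) (\<sigma> U) = res V (U \<inter> V) (\<sigma> V)) \<longrightarrow>
             (\<exists>s\<in>F W. \<forall>U\<in>\<U>. res W U s = \<sigma> U)))"

definition sheaf_of_sets ::
    "'a topology \<Rightarrow> ('a set \<Rightarrow> 'b set) \<Rightarrow> ('a set \<Rightarrow> 'a set \<Rightarrow> 'b \<Rightarrow> 'b) \<Rightarrow> bool" where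
  "sheaf_of_sets X F res \<longleftrightarrow>
     presheaf_of_sets X F res \<and> sheaf_locality X F res \<and> sheaf_gluing X F res"

definition borel_sets :: "'a topology \<Rightarrow> 'a set set" where
  "borel_sets X = sigma_sets (topspace X) {V. openin X V}"

(* An element of the type 'a measure bundles its underlying set, its sigma-algebra and a
   measure with values in [0,\<infinity>] that is set to 0 off the sigma-algebra. With the first two
   components fixed, equality in this type is equality of measures (measure_eqI). *)
definition borel_measures :: "'a topology \<Rightarrow> 'a set \<Rightarrow> 'a measure set" where
  "borel_measures X U =
     {\<mu>. space \<mu> = U \<and> sets \<mu> = borel_sets (subtopology X U)}"

definition measure_restriction :: "'a set \<Rightarrow> 'a set \<Rightarrow> 'a measure \<Rightarrow> 'a measure" where
  "measure_restriction U V \<mu> = restrict_space \<mu> V"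

lemma openin_in_borel_sets: "openin X V \<Longrightarrow> V \<in> borel_sets X"
  by (simp add: borel_sets_def sigma_sets.Basic)

(* restrict_space is the restriction of measures: it carries the Borel sigma-algebra of V
   and agrees with \<mu> on the subsets of V. *)
lemma
  assumes "openin X U" "openin X V" "V \<subseteq> U" "\<mu> \<in> borel_measures X U"
  shows measure_restriction_in_borel_measures:
      "measure_restriction U V \<mu> \<in> borel_measures X V"
    and emeasure_measure_restriction:
      "B \<in> borel_sets (subtopology X V) \<Longrightarrow> emeasure (measure_restriction U V \<mu>) B = emeasure \<mu> B"
proof -
  have sp: "space \<mu> = U" and st: "sets \<mu> = borel_sets (subtopology X U)"
    using assms(4) by (auto simp: borel_measures_def)
  have top: "topspace (subtopology X U) = U" "topspace (subtopology X V) = V"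
    using assms(1,2) by (auto dest: openin_subset)
  have V: "openin (subtopology X U) V"
    using assms(1,2,3) by (simp add: openin_open_subtopology)
  then have VS: "V \<in> sets \<mu>"
    using st openin_in_borel_sets by blast
  have "(\<inter>) V ` {S. openin (subtopology X U) S} = {S. openin (subtopology X V) S}"
  proof (intro equalityI subsetI)
    fix S assume "S \<in> (\<inter>) V ` {S. openin (subtopology X U) S}"
    then show "S \<in> {S. openin (subtopology X V) S}"
      using assms(1,2) by (auto simp: openin_open_subtopology)
  next
    fix S assume "S \<in> {S. openin (subtopology X V) S}"
    then have "openin (subtopology X U) S" "S = V \<inter> S"
      using assms(1,2,3) by (auto simp: openin_open_subtopology)
    then show "S \<in> (\<inter>) V ` {S. openin (subtopology X U) S}"
      by blast
  qed
  then have sets: "sets (restrict_space \<mu> V) = borel_sets (subtopology X V)"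
    using VS assms(3) unfolding sets_restrict_space st borel_sets_def top
    by (subst sigma_sets_Int) auto
  then show "measure_restriction U V \<mu> \<in> borel_measures X V"
    using assms(3) sp by (auto simp: borel_measures_def measure_restriction_def space_restrict_space)
  assume "B \<in> borel_sets (subtopology X V)"
  then have "B \<subseteq> V"
    using sets sets.sets_into_space[of B "restrict_space \<mu> V"]
    by (auto simp: space_restrict_space)
  then show "emeasure (measure_restriction U V \<mu>) B = emeasure \<mu> B"
    unfolding measure_restriction_def using VS sp assms(3)
    by (intro emeasure_restrict_space) (auto simp: Int_absorb2)
qed

end

(* Second countability makes every open set Lindelof, so an open cover of W can be replaced by a
   countable one A and W becomes the disjoint union of Borel sets D n contained in A n. A measure
   mu on W satisfies mu B = (SUM n. mu (B \<inter> D n)), which only involves the restrictions of mu to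
   the A n: this gives locality, and it is also the formula that defines the glued measure. *)
theory Submission
  imports Defs
begin

lemma sets_borel_measures: "\<mu> \<in> borel_measures X U \<Longrightarrow> sets \<mu> = borel_sets (subtopology X U)"
  by (simp add: borel_measures_def)

lemma sigma_algebra_borel_sets: "sigma_algebra (topspace X) (borel_sets X)"
  unfolding borel_sets_def
  by (rule sigma_algebra_sigma_sets) (auto dest: openin_subset)

text \<open>The trace of a generated sigma-algebra is generated by the traces of the generators, and
  since \<open>U\<close> is itself Borel the trace consists of the Borel sets inside
  \<open>U\<close>. With this form, passing between open subsets is a matter of inclusions within
  the single sigma-algebra \<open>borel_sets X\<close>.\<close>

lemma borel_sets_open_subtopology:
  assumes "openin X U"
  shows "borel_sets (subtopology X U) = {B \<in> borel_sets X. B \<subseteq> U}"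
proof -
  interpret sigma_algebra "topspace X" "borel_sets X"
    by (rule sigma_algebra_borel_sets)
  have U: "U \<in> borel_sets X" "U \<subseteq> topspace X"
    using assms by (auto simp: openin_in_borel_sets openin_subset)
  have "(\<inter>) U ` {V. openin X V} = {V. openin (subtopology X U) V}"
    by (auto simp: openin_subtopology)
  then have "(\<inter>) U ` borel_sets X = borel_sets (subtopology X U)"
    using sigma_sets_Int[of U "topspace X" "{V. openin X V}"] U
    by (simp add: borel_sets_def Int_absorb1)
  moreover have "(\<inter>) U ` borel_sets X = {B \<in> borel_sets X. B \<subseteq> U}"
    using U(1) by (auto simp: Int_absorb1 image_iff)
  ultimately show ?thesis
    by simp
qed

text \<open>Every iterated restriction takes the values of the original measure, so each equality of
  measures reduces to equal sigma-algebras and \<open>emeasure_measure_restriction\<close>.\<close>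

lemma presheaf_borel_measures: "presheaf_of_sets X (borel_measures X) measure_restriction"
  unfolding presheaf_of_sets_def
proof (intro conjI allI impI ballI)
  fix U V assume "openin X U \<and> openin X V \<and> V \<subseteq> U"
  then show "measure_restriction U V \<in> borel_measures X U \<rightarrow> borel_measures X V"
    by (auto intro: measure_restriction_in_borel_measures)
next
  fix U \<mu> assume U: "openin X U" and \<mu>: "\<mu> \<in> borel_measures X U"
  then have "measure_restriction U U \<mu> \<in> borel_measures X U"
    by (auto intro: measure_restriction_in_borel_measures)
  with U \<mu> show "measure_restriction U U \<mu> = \<mu>"
    by (auto intro!: measure_eqI simp: sets_borel_measures emeasure_measure_restriction)
next
  fix U V W \<mu>
  assume "openin X U \<and> openin X V \<and> openin X W \<and> W \<subseteq> V \<and> V \<subseteq> U"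
  then have UVW: "openin X U" "openin X V" "openin X W" "W \<subseteq> V" "V \<subseteq> U" "W \<subseteq> U"
    by auto
  assume \<mu>: "\<mu> \<in> borel_measures X U"
  note V = measure_restriction_in_borel_measures[OF UVW(1,2,5) \<mu>]
  note VW = measure_restriction_in_borel_measures[OF UVW(2,3,4) V]
  note W = measure_restriction_in_borel_measures[OF UVW(1,3,6) \<mu>]
  show "measure_restriction V W (measure_restriction U V \<mu>) = measure_restriction U W \<mu>"
  proof (rule measure_eqI)
    fix B assume "B \<in> sets (measure_restriction V W (measure_restriction U V \<mu>))"
    then have B: "B \<in> borel_sets (subtopology X W)"
      using VW by (simp add: sets_borel_measures)
    \<comment> \<open>Evaluating the inner restriction at \<open>B\<close> requires \<open>B\<close>
      to be Borel in \<open>V\<close> as well as in \<open>W\<close>.\<close>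
    then have "B \<in> borel_sets (subtopology X V)"
      using UVW by (auto simp: borel_sets_open_subtopology)
    with B UVW V \<mu> show "emeasure (measure_restriction V W (measure_restriction U V \<mu>)) B =
        emeasure (measure_restriction U W \<mu>) B"
      by (simp add: emeasure_measure_restriction)
  qed (use VW W in \<open>simp add: sets_borel_measures\<close>)
qed

text \<open>The index type is \<open>nat\<close> even if the countable subcover is finite or empty,
  so some \<open>A n\<close> may fail to be in the cover. This happens only where \<open>D n\<close>
  is empty, hence the condition in the fourth conclusion.\<close>

lemma open_cover_disjoint_refinement:
  assumes "second_countable X" "open_cover X \<U> W"
  obtains D A :: "nat \<Rightarrow> 'a set"
  where "disjoint_family D" "(\<Union>n. D n) = W" "\<And>n. D n \<in> borel_sets X"
    "\<And>n. D n \<noteq> {} \<Longrightarrow> A n \<in> \<U>" "\<And>n. D n \<subseteq> A n"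
proof -
  interpret sigma_algebra "topspace X" "borel_sets X"
    by (rule sigma_algebra_borel_sets)
  have \<U>: "\<And>U. U \<in> \<U> \<Longrightarrow> openin X U" "\<Union>\<U> = W"
    using assms(2) by (auto simp: open_cover_def)
  then have W: "W \<subseteq> topspace X"
    by (auto dest: openin_subset)
  have "Lindelof_space (subtopology X W)"
    using assms(1) second_countable_subtopology second_countable_imp_Lindelof_space by blast
  then obtain \<V> where \<V>: "countable \<V>" "\<V> \<subseteq> \<U>" "W \<subseteq> \<Union>\<V>"
    using Lindelof_space_subtopology_subset[OF W] \<U> by (metis order_refl)
  \<comment> \<open>Adding the empty set makes the enumerated family nonempty, as
    \<open>range_from_nat_into\<close> demands, without changing its union.\<close>
  define A where "A = from_nat_into (insert {} \<V>)"
  have range: "range A = insert {} \<V>"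
    unfolding A_def using \<V>(1) by (intro range_from_nat_into) auto
  have A: "A n = {} \<or> A n \<in> \<U>" for n
    using range \<V>(2) by blast
  have "A n \<in> borel_sets X" for n
    using A[of n] \<U>(1)[of "A n"] by (auto simp: openin_in_borel_sets)
  then have "range A \<subseteq> borel_sets X"
    by auto
  then have "range (disjointed A) \<subseteq> borel_sets X"
    by (rule range_disjointed_sets)
  moreover have "(\<Union>n. disjointed A n) = W"
    using range \<V> \<U>(2) unfolding UN_disjointed_eq by auto
  moreover have "A n \<in> \<U>" if "disjointed A n \<noteq> {}" for n
    using that A[of n] disjointed_subset[of A n] by auto
  ultimately show thesis
    by (intro that[of "disjointed A" A])
      (auto intro: disjoint_family_disjointed dest: subsetD[OF disjointed_subset])
qed

text \<open>Measurability is asked of the pieces \<open>B \<inter> D n\<close> and not of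
  \<open>D n\<close>: for the measure on a member \<open>U\<close> of the cover, \<open>D n\<close>
  may stick out of \<open>U\<close>.\<close>

lemma suminf_emeasure_Int:
  assumes "disjoint_family D" "B \<subseteq> (\<Union>n. D n)" "\<And>n. B \<inter> D n \<in> sets M"
  shows "(\<Sum>n. emeasure M (B \<inter> D n)) = emeasure M B"
proof -
  have "disjoint_family (\<lambda>n. B \<inter> D n)"
    using assms(1) by (auto simp: disjoint_family_on_def)
  then have "(\<Sum>n. emeasure M (B \<inter> D n)) = emeasure M (\<Union>n. B \<inter> D n)"
    using assms(3) by (intro suminf_emeasure) auto
  also have "(\<Union>n. B \<inter> D n) = B"
    using assms(2) by auto
  finally show ?thesis .
qed

text \<open>Sums over \<open>nat\<close> are integrals against counting measure, and integration
  commutes with countable sums of nonnegative functions.\<close>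

lemma suminf_swap_ennreal:
  fixes f :: "nat \<Rightarrow> nat \<Rightarrow> ennreal"
  shows "(\<Sum>i. \<Sum>n. f i n) = (\<Sum>n. \<Sum>i. f i n)"
  using nn_integral_suminf[of "\<lambda>i n. f i n" "count_space UNIV"]
  by (simp add: nn_integral_count_space_nat)

text \<open>Meant for the gluing formula, where the \<open>M n\<close> are different measures on
  different open sets. Each summand is countably additive in \<open>B\<close>, and the two sums may
  be interchanged because all terms are nonnegative.\<close>

lemma countably_additive_suminf_emeasure_Int:
  assumes "\<And>B n. B \<in> S \<Longrightarrow> B \<inter> D n \<in> sets (M n)"
  shows "countably_additive S (\<lambda>B. \<Sum>n. emeasure (M n) (B \<inter> D n))"
  unfolding countably_additive_def
proof (intro allI impI)
  fix B :: "nat \<Rightarrow> 'a set"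
  assume B: "range B \<subseteq> S" "disjoint_family B"
  have "(\<Sum>i. emeasure (M n) (B i \<inter> D n)) = emeasure (M n) ((\<Union>i. B i) \<inter> D n)" for n
  proof -
    have "disjoint_family (\<lambda>i. B i \<inter> D n)"
      using B(2) by (auto simp: disjoint_family_on_def)
    then have "(\<Sum>i. emeasure (M n) (B i \<inter> D n)) = emeasure (M n) (\<Union>i. B i \<inter> D n)"
      using B(1) assms by (intro suminf_emeasure) auto
    then show ?thesis
      by simp
  qed
  then show "(\<Sum>i. \<Sum>n. emeasure (M n) (B i \<inter> D n)) =
      (\<Sum>n. emeasure (M n) (\<Union> (range B) \<inter> D n))"
    by (subst suminf_swap_ennreal) simp
qed

lemma locality_borel_measures:
  assumes "second_countable X"
  shows "sheaf_locality X (borel_measures X) measure_restriction"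
  unfolding sheaf_locality_def
proof (intro allI impI ballI)
  interpret sigma_algebra "topspace X" "borel_sets X"
    by (rule sigma_algebra_borel_sets)
  fix W \<U> \<mu> \<nu>
  assume "openin X W \<and> open_cover X \<U> W"
  then have W: "openin X W" and cover: "open_cover X \<U> W"
    by auto
  assume \<mu>: "\<mu> \<in> borel_measures X W" and \<nu>: "\<nu> \<in> borel_measures X W"
    and eq: "\<forall>U\<in>\<U>. measure_restriction W U \<mu> = measure_restriction W U \<nu>"
  obtain D A :: "nat \<Rightarrow> 'a set"
    where D: "disjoint_family D" "(\<Union>n. D n) = W" "\<And>n. D n \<in> borel_sets X"
      "\<And>n. D n \<noteq> {} \<Longrightarrow> A n \<in> \<U>" "\<And>n. D n \<subseteq> A n"
    using open_cover_disjoint_refinement[OF assms cover] by metis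
  show "\<mu> = \<nu>"
  proof (rule measure_eqI)
    fix B assume "B \<in> sets \<mu>"
    then have B: "B \<in> borel_sets X" "B \<subseteq> W"
      using \<mu> W by (auto simp: sets_borel_measures borel_sets_open_subtopology)
    have "emeasure \<mu> (B \<inter> D n) = emeasure \<nu> (B \<inter> D n)" for n
    \<comment> \<open>For empty \<open>D n\<close> nothing is known about \<open>A n\<close>, but
      both sides are 0. Otherwise \<open>A n\<close> belongs to the cover and the restrictions to
      it, equal by \<open>eq\<close>, both see \<open>B \<inter> D n\<close>.\<close>
    proof (cases "D n = {}")
      case False
      then have "A n \<in> \<U>"
        by (rule D)
      then have A: "openin X (A n)" "A n \<subseteq> W"
        using cover by (auto simp: open_cover_def)
      then have "B \<inter> D n \<in> borel_sets (subtopology X (A n))"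
        using B D(3,5)[of n] by (auto simp: borel_sets_open_subtopology)
      then show ?thesis
        using \<open>A n \<in> \<U>\<close> eq W A \<mu> \<nu> by (metis emeasure_measure_restriction)
    qed simp
    moreover have "B \<inter> D n \<in> borel_sets (subtopology X W)" for n
      using B D W by (auto simp: borel_sets_open_subtopology)
    ultimately show "emeasure \<mu> B = emeasure \<nu> B"
      using suminf_emeasure_Int[of D B \<mu>] suminf_emeasure_Int[of D B \<nu>] D(1,2) B(2) \<mu> \<nu>
      by (simp add: sets_borel_measures)
  qed (use \<mu> \<nu> in \<open>simp add: sets_borel_measures\<close>)
qed

lemma gluing_borel_measures:
  assumes "second_countable X"
  shows "sheaf_gluing X (borel_measures X) measure_restriction"
  unfolding sheaf_gluing_def
proof (intro allI impI)
  interpret sigma_algebra "topspace X" "borel_sets X"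
    by (rule sigma_algebra_borel_sets)
  fix W \<U> \<sigma>
  assume "openin X W \<and> open_cover X \<U> W"
  then have W: "openin X W" and cover: "open_cover X \<U> W"
    by auto
  assume \<sigma>: "(\<forall>U\<in>\<U>. \<sigma> U \<in> borel_measures X U) \<and>
    (\<forall>U\<in>\<U>. \<forall>V\<in>\<U>. measure_restriction U (U \<inter> V) (\<sigma> U) = measure_restriction V (U \<inter> V) (\<sigma> V))"
  have \<U>: "openin X U" "U \<subseteq> W" "\<sigma> U \<in> borel_measures X U" if "U \<in> \<U>" for U
    using that cover \<sigma> by (auto simp: open_cover_def)
  have sets: "sets (\<sigma> U) = {B \<in> borel_sets X. B \<subseteq> U}" if "U \<in> \<U>" for U
    using \<U>[OF that] by (simp add: sets_borel_measures borel_sets_open_subtopology)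
  \<comment> \<open>The compatibility hypothesis in terms of values; it enters the proof only
    through this fact.\<close>
  have overlap: "emeasure (\<sigma> U) B = emeasure (\<sigma> V) B"
    if UV: "U \<in> \<U>" "V \<in> \<U>" and B: "B \<in> borel_sets X" "B \<subseteq> U \<inter> V" for U V B
  proof -
    have UV_open: "openin X (U \<inter> V)"
      using \<U> UV by blast
    then have "B \<in> borel_sets (subtopology X (U \<inter> V))"
      using B by (simp add: borel_sets_open_subtopology)
    then show ?thesis
      using \<sigma> UV \<U> UV_open by (metis emeasure_measure_restriction inf_le1 inf_le2)
  qed
  obtain D A :: "nat \<Rightarrow> 'a set"
    where D: "disjoint_family D" "(\<Union>n. D n) = W" "\<And>n. D n \<in> borel_sets X"
      "\<And>n. D n \<noteq> {} \<Longrightarrow> A n \<in> \<U>" "\<And>n. D n \<subseteq> A n"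
    using open_cover_disjoint_refinement[OF assms cover] by metis
  define S where "S = borel_sets (subtopology X W)"
  have S_eq: "S = {B \<in> borel_sets X. B \<subseteq> W}"
    unfolding S_def using W by (rule borel_sets_open_subtopology)
  have "topspace (subtopology X W) = W"
    using W by (auto dest: openin_subset)
  then have S: "sigma_algebra W S"
    using sigma_algebra_borel_sets[of "subtopology X W"] by (simp add: S_def)
  then interpret S: sigma_algebra W S .
  \<comment> \<open>If \<open>D n\<close> is empty, \<open>\<sigma> (A n)\<close> may be an
    arbitrary measure, but it is then evaluated at the empty set and contributes 0.\<close>
  define f where "f B = (\<Sum>n. emeasure (\<sigma> (A n)) (B \<inter> D n))" for B
  define \<mu> where "\<mu> = measure_of W S f"
  have "B \<inter> D n \<in> sets (\<sigma> (A n))" if "B \<in> S" for B n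
  proof (cases "D n = {}")
    case False
    then show ?thesis
      using that D(3,5)[of n] by (auto simp: sets[OF D(4)] S_eq)
  qed simp
  then have "countably_additive S f"
    unfolding f_def by (rule countably_additive_suminf_emeasure_Int)
  moreover have "positive S f"
    by (simp add: positive_def f_def)
  ultimately have emeasure_\<mu>: "emeasure \<mu> B = f B" if "B \<in> S" for B
    unfolding \<mu>_def using S that by (intro emeasure_measure_of_sigma)
  have \<mu>: "\<mu> \<in> borel_measures X W"
    using S.space_closed by (simp add: borel_measures_def \<mu>_def S_def[symmetric])
  have "measure_restriction W U \<mu> = \<sigma> U" if U: "U \<in> \<U>" for U
  proof (rule measure_eqI)
    show sets_eq: "sets (measure_restriction W U \<mu>) = sets (\<sigma> U)"
      using measure_restriction_in_borel_measures[OF W \<U>(1,2)[OF U] \<mu>] \<U>(3)[OF U]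
      by (simp add: sets_borel_measures)
    fix B assume "B \<in> sets (measure_restriction W U \<mu>)"
    then have B: "B \<in> borel_sets X" "B \<subseteq> U"
      using sets_eq sets[OF U] by auto
    then have "B \<in> S" "B \<in> borel_sets (subtopology X U)"
      using \<U>(1,2)[OF U] by (auto simp: S_eq borel_sets_open_subtopology)
    then have "emeasure (measure_restriction W U \<mu>) B = f B"
      using emeasure_measure_restriction[OF W \<U>(1,2)[OF U] \<mu>] emeasure_\<mu> by simp
    \<comment> \<open>Since \<open>B \<inter> D n\<close> lies in both \<open>A n\<close> and
      \<open>U\<close>, \<open>overlap\<close> replaces the measure chosen for the piece
      \<open>D n\<close> by \<open>\<sigma> U\<close>.\<close>
    also have "f B = (\<Sum>n. emeasure (\<sigma> U) (B \<inter> D n))"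
    proof -
      have "emeasure (\<sigma> (A n)) (B \<inter> D n) = emeasure (\<sigma> U) (B \<inter> D n)" for n
      proof (cases "D n = {}")
        case False
        then show ?thesis
          using U B D(3,5)[of n] by (intro overlap D(4)) auto
      qed simp
      then show ?thesis
        by (simp add: f_def)
    qed
    \<comment> \<open>The pieces \<open>D n\<close> cover \<open>B\<close> because \<open>U\<close>
      is contained in \<open>W\<close>.\<close>
    also have "\<dots> = emeasure (\<sigma> U) B"
      using D B \<U>(2)[OF U] by (intro suminf_emeasure_Int) (auto simp: sets[OF U])
    finally show "emeasure (measure_restriction W U \<mu>) B = emeasure (\<sigma> U) B" .
  qed
  with \<mu> show "\<exists>s\<in>borel_measures X W. \<forall>U\<in>\<U>. measure_restriction W U s = \<sigma> U"
    by blast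
qed

theorem proposition3p3:
  fixes X :: "'a topology"
  assumes "second_countable X"
  shows "sheaf_of_sets X (borel_measures X) measure_restriction"
  unfolding sheaf_of_sets_def
  using assms presheaf_borel_measures locality_borel_measures gluing_borel_measures by blast

end
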